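(* Consider the model $Y=(\Psi^*+A^*B^* )^TX+(B^* )^TW+E$ described in the context with $\mathbb{E}[W\mid X]=0$, and assume $\Psi^*P_{B^*}+A^*B^*\neq 0$. If $\mathrm{rank}(\Sigma_W)<K$, then $\Theta^*=\Psi^*P_{B^*}^{\perp}$ is not identifiable: there exist two configurations satisfying these conditions that induce the same joint distribution of $(X,Y)$ but have different values of $\Theta^*$.
   Context: Model. $p,m,K$ are positive integers with $K<m$. $Y\in\mathbb{R}^m$ (response), $X\in\mathbb{R}^p$ (observed), $Z\in\mathbb{R}^K$ (unobserved hidden variables), $E\in\mathbb{R}^m$ (error) are mean-zero random vectors with finite second moments satisfying $Y=(\Psi^* )^TX+(B^* )^TZ+E$, where $\Psi^*\in\mathbb{R}^{p\times m}$, $B^*\in\mathbb{R}^{K\times m}$ are deterministic, $\mathrm{rank}(B^* )=K$, $E$ is independent of $(X,Z)$ with diagonal covariance matrix $\Sigma_E$, and $\Sigma=\mathrm{Cov}(X)$, $\Sigma_Z=\mathrm{Cov}(Z)$ are strictly positive definite. Put $A^*=\{\mathbb{E}[XX^T]\}^{-1}\mathbb{E}[XZ^T]\in\mathbb{R}^{p\times K}$, $W=Z-(A^* )^TX$, $\Sigma_W=\mathrm{Cov}(W)$. Then $Y=(\Psi^*+A^*B^* )^TX+(B^* )^TW+E$. $P_{B^*}=B^{*T}(B^*B^{*T})^{-1}B^*$ is the orthogonal projection onto the row space of $B^*$ and $P_{B^*}^\perp=I_m-P_{B^*}$. A configuration is a choice of $\Psi^*\in\mathbb{R}^{p\times m}$,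 $B^*\in\mathbb{R}^{K\times m}$ and a joint law of $(X,Z,E)$ such that $\mathrm{rank}(B^* )=K$, the vectors $X,Z,E$ have mean zero and finite second moments, $E$ is independent of $(X,Z)$ with diagonal covariance matrix, and $\mathrm{Cov}(X)$, $\mathrm{Cov}(Z)$ are strictly positive definite; it induces a joint law of $(X,Y)$ through $Y=(\Psi^* )^TX+(B^* )^TZ+E$. A quantity attached to configurations is identifiable over a class of configurations if any two configurations in the class that induce the same joint law of the observable pair $(X,Y)$ have the same value of that quantity; otherwise it is not identifiable. *)

theory Defs
  imports "HOL-Probability.Probability"
begin

(* Rows are indexed by the outer index: a p x m matrix has type real^'m^'p. *)

definition second_moment :: "'a measure \<Rightarrow> ('a \<Rightarrow> real^'i) \<Rightarrow> ('a \<Rightarrow> real^'j) \<Rightarrow> real^'j^'i" where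
  "second_moment M U V = (\<chi> i j. \<integral>\<omega>. U \<omega> $ i * V \<omega> $ j \<partial>M)"

definition Cov :: "'a measure \<Rightarrow> ('a \<Rightarrow> real^'i) \<Rightarrow> real^'i^'i" where
  "Cov M U = second_moment M (\<lambda>\<omega>. U \<omega> - (\<integral>\<omega>'. U \<omega>' \<partial>M)) (\<lambda>\<omega>. U \<omega> - (\<integral>\<omega>'. U \<omega>' \<partial>M))"

definition pos_def :: "real^'i^'i \<Rightarrow> bool" where
  "pos_def S \<longleftrightarrow> transpose S = S \<and> (\<forall>v. v \<noteq> 0 \<longrightarrow> v \<bullet> (S *v v) > 0)"

definition diagonal :: "real^'i^'i \<Rightarrow> bool" where
  "diagonal S \<longleftrightarrow> (\<forall>i j. i \<noteq> j \<longrightarrow> S $ i $ j = 0)"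

(* prob_space.indep_var relates variables with one common codomain type only,
   so independence is stated for the generated sigma-algebras. *)
definition indep_rv :: "'a measure \<Rightarrow> ('a \<Rightarrow> 'b::topological_space) \<Rightarrow> ('a \<Rightarrow> 'c::topological_space) \<Rightarrow> bool" where
  "indep_rv M U V \<longleftrightarrow>
     U \<in> borel_measurable M \<and> V \<in> borel_measurable M \<and>
     prob_space.indep_set M (sets (vimage_algebra (space M) U borel)) (sets (vimage_algebra (space M) V borel))"

definition cond_mean_zero :: "'a measure \<Rightarrow> ('a \<Rightarrow> real^'i) \<Rightarrow> ('a \<Rightarrow> 'b::topological_space) \<Rightarrow> bool" where
  "cond_mean_zero M U V \<longleftrightarrow>
     (\<forall>i. AE \<omega> in M. real_cond_exp M (vimage_algebra (space M) V borel) (\<lambda>\<omega>. U \<omega> $ i) \<omega> = 0)"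

definition row_proj :: "real^'m^'k \<Rightarrow> real^'m^'m" where
  "row_proj B = transpose B ** matrix_inv (B ** transpose B) ** B"

(* law is the joint law of (X, Z, E); X_rv, Z_rv, E_rv are its coordinate projections. *)
record ('p::finite, 'm::finite, 'k::finite) config =
  Psi_mat :: "real^'m^'p"
  B_mat :: "real^'m^'k"
  law :: "((real^'p) \<times> (real^'k) \<times> (real^'m)) measure"

definition X_rv :: "(real^'p) \<times> (real^'k) \<times> (real^'m) \<Rightarrow> real^'p" where
  "X_rv \<omega> = fst \<omega>"

definition Z_rv :: "(real^'p) \<times> (real^'k) \<times> (real^'m) \<Rightarrow> real^'k" where
  "Z_rv \<omega> = fst (snd \<omega>)"

definition E_rv :: "(real^'p) \<times> (real^'k) \<times> (real^'m) \<Rightarrow> real^'m" where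
  "E_rv \<omega> = snd (snd \<omega>)"

definition mean_zero_L2 :: "'a measure \<Rightarrow> ('a \<Rightarrow> real^'i) \<Rightarrow> bool" where
  "mean_zero_L2 M U \<longleftrightarrow>
     U \<in> borel_measurable M \<and> integrable M (\<lambda>\<omega>. (norm (U \<omega>))\<^sup>2) \<and> (\<integral>\<omega>. U \<omega> \<partial>M) = 0"

definition configuration :: "('p::finite, 'm::finite, 'k::finite) config \<Rightarrow> bool" where
  "configuration c \<longleftrightarrow>
     rank (B_mat c) = CARD('k) \<and>
     sets (law c) = sets borel \<and> prob_space (law c) \<and>
     mean_zero_L2 (law c) X_rv \<and> mean_zero_L2 (law c) Z_rv \<and> mean_zero_L2 (law c) E_rv \<and>
     indep_rv (law c) E_rv (\<lambda>\<omega>. (X_rv \<omega>, Z_rv \<omega>)) \<and>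
     diagonal (Cov (law c) E_rv) \<and>
     pos_def (Cov (law c) X_rv) \<and> pos_def (Cov (law c) Z_rv)"

definition Y_rv :: "('p::finite, 'm::finite, 'k::finite) config
    \<Rightarrow> (real^'p) \<times> (real^'k) \<times> (real^'m) \<Rightarrow> real^'m" where
  "Y_rv c \<omega> = transpose (Psi_mat c) *v X_rv \<omega> + transpose (B_mat c) *v Z_rv \<omega> + E_rv \<omega>"

definition A_mat :: "('p::finite, 'm::finite, 'k::finite) config \<Rightarrow> real^'k^'p" where
  "A_mat c = matrix_inv (second_moment (law c) X_rv X_rv) ** second_moment (law c) X_rv Z_rv"

definition W_rv :: "('p::finite, 'm::finite, 'k::finite) config
    \<Rightarrow> (real^'p) \<times> (real^'k) \<times> (real^'m) \<Rightarrow> real^'k" where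
  "W_rv c \<omega> = Z_rv \<omega> - transpose (A_mat c) *v X_rv \<omega>"

lemma Y_rv_eq:
  "Y_rv c \<omega> = transpose (Psi_mat c + A_mat c ** B_mat c) *v X_rv \<omega> + transpose (B_mat c) *v W_rv c \<omega> + E_rv \<omega>"
proof -
  have "transpose (Psi_mat c + A_mat c ** B_mat c) = transpose (Psi_mat c) + transpose (B_mat c) ** transpose (A_mat c)"
    by (simp add: matrix_transpose_mul[symmetric]) (simp add: transpose_def vec_eq_iff)
  then show ?thesis
    by (simp add: Y_rv_def W_rv_def matrix_vector_mult_add_rdistrib matrix_vector_mult_diff_distrib
        matrix_vector_mul_assoc del: transpose_matrix_vector)
qed

definition Theta :: "('p::finite, 'm::finite, 'k::finite) config \<Rightarrow> real^'m^'p" where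
  "Theta c = Psi_mat c ** (mat 1 - row_proj (B_mat c))"

definition obs_law :: "('p::finite, 'm::finite, 'k::finite) config \<Rightarrow> ((real^'p) \<times> (real^'m)) measure" where
  "obs_law c = distr (law c) borel (\<lambda>\<omega>. (X_rv \<omega>, Y_rv c \<omega>))"

definition identifiable_over ::
    "('p::finite, 'm::finite, 'k::finite) config set \<Rightarrow> (('p, 'm, 'k) config \<Rightarrow> 'q) \<Rightarrow> bool" where
  "identifiable_over C q \<longleftrightarrow> (\<forall>c\<in>C. \<forall>c'\<in>C. obs_law c = obs_law c' \<longrightarrow> q c = q c')"

end

theory Submission
  imports Defs
begin

text \<open>
  If $\Sigma_W$ is singular, some row combination of $B$ is not seen through $B^T W$ and can be
  traded against $\Psi$. Choose a law with $E = 0$ and $W_{k_0} = 0$, $Z_{k_0} = X_{p_0}$ almost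
  surely, under which a uniformly chosen one of the coordinates $X_p$, $Z_k$ ($k \neq k_0$) gets a
  random sign and the others vanish (nothing happens if $k_0$ is drawn); then the covariances are
  scalar and $A = e_{p_0} e_{k_0}^T$. Let the rows of $B$ be distinct unit vectors $e_{g(k)}$
  and let $\Psi = e_{p_0} e_m^T$ with $m$ outside the range of $g$. Then $X_{p_0}$ enters $Y$ through
  $e_m + e_{g(k_0)}$, so exchanging $m$ and $g(k_0)$ leaves $Y$ unchanged, while
  $\Theta = \Psi$ changes.
\<close>

section \<open>Matrix inverses and the finite law of (X, Z, E)\<close>

lemma matrix_inv_eqI:
  fixes A B :: "real^'n^'n"
  assumes "A ** B = mat 1"
  shows "matrix_inv A = B"
proof -
  have BA: "B ** A = mat 1"
    using assms matrix_left_right_inverse by blast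
  \<comment> \<open>\<open>matrix_inv\<close> is defined by choice; \<open>B\<close> witnesses that
    a two-sided inverse exists, and uniqueness then identifies the chosen one with
    \<open>B\<close>.\<close>
  have "A ** matrix_inv A = mat 1 \<and> matrix_inv A ** A = mat 1"
    unfolding matrix_inv_def by (rule someI[of _ B]) (use assms BA in simp)
  then show ?thesis
    by (metis BA matrix_mul_assoc matrix_mul_lid matrix_mul_rid)
qed

text \<open>The left or right tag says which coordinate is drawn, the Boolean is its random sign. At
  \<open>Inl p0\<close> the coordinate Z_k0 copies X_p0 and gets its variance from there; leaving
  \<open>Inr k0\<close> empty keeps this variance equal to the others and the copy exact.\<close>

fun atom :: "'p \<Rightarrow> 'k \<Rightarrow> ('p::finite + 'k::finite) \<times> bool
    \<Rightarrow> (real^'p) \<times> (real^'k) \<times> (real^'m::finite)" where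
  "atom p0 k0 (Inl p, b) =
     (axis p (if b then 1 else -1), if p = p0 then axis k0 (if b then 1 else -1) else 0, 0)"
| "atom p0 k0 (Inr k, b) =
     (0, if k = k0 then 0 else axis k (if b then 1 else -1), 0)"

definition atom_law :: "'p \<Rightarrow> 'k \<Rightarrow> ((real^'p::finite) \<times> (real^'k::finite) \<times> (real^'m::finite)) measure"
  where "atom_law p0 k0 = distr (measure_pmf (pmf_of_set UNIV)) borel (atom p0 k0)"

lemma sets_atom_law [simp, measurable_cong]: "sets (atom_law p0 k0) = sets borel"
  and space_atom_law [simp]: "space (atom_law p0 k0) = UNIV"
  by (simp_all add: atom_law_def)

lemma prob_space_atom_law: "prob_space (atom_law p0 k0)"
  unfolding atom_law_def
  by (rule prob_space.prob_space_distr) (auto simp: measure_pmf.prob_space_axioms)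

lemma measurable_coordinates [measurable]:
  "X_rv \<in> borel_measurable borel" "Z_rv \<in> borel_measurable borel" "E_rv \<in> borel_measurable borel"
  unfolding X_rv_def Z_rv_def E_rv_def
  by (auto intro!: borel_measurable_continuous_onI continuous_intros)

lemma measurable_coordinates_nth [measurable]:
  "(\<lambda>\<omega>. X_rv \<omega> $ i) \<in> borel_measurable borel" "(\<lambda>\<omega>. Z_rv \<omega> $ j) \<in> borel_measurable borel"
  "(\<lambda>\<omega>. E_rv \<omega> $ l) \<in> borel_measurable borel"
  unfolding X_rv_def Z_rv_def E_rv_def
  by (auto intro!: borel_measurable_continuous_onI continuous_intros)

lemma measurable_W_rv [measurable]:
  "W_rv c \<in> borel_measurable borel" "(\<lambda>\<omega>. W_rv c \<omega> $ j) \<in> borel_measurable borel"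
  unfolding W_rv_def X_rv_def Z_rv_def
  by (auto intro!: borel_measurable_continuous_onI continuous_intros
      linear_continuous_on_compose[OF _ matrix_vector_mul_linear] simp del: transpose_matrix_vector)

lemma integrable_atom_law:
  fixes h :: "_ \<Rightarrow> 'b::{banach, second_countable_topology}"
  assumes "h \<in> borel_measurable borel"
  shows "integrable (atom_law p0 k0) h"
  unfolding atom_law_def
  by (subst integrable_distr_eq) (auto simp: assms intro: integrable_measure_pmf_finite)

text \<open>The two signs of each draw are kept side by side so that odd contributions cancel within
  a summand.\<close>

lemma integral_atom_law:
  fixes h :: "(real^'p::finite) \<times> (real^'k::finite) \<times> (real^'m::finite)
    \<Rightarrow> 'b::{banach, second_countable_topology}"
  assumes "h \<in> borel_measurable borel"
  shows "(\<integral>\<omega>. h \<omega> \<partial>atom_law p0 k0) = (1 / (2 * real CARD('p + 'k))) *\<^sub>R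
    ((\<Sum>p\<in>UNIV. h (atom p0 k0 (Inl p, True)) + h (atom p0 k0 (Inl p, False))) +
     (\<Sum>k\<in>UNIV. h (atom p0 k0 (Inr k, True)) + h (atom p0 k0 (Inr k, False))))"
proof -
  have "(\<integral>\<omega>. h \<omega> \<partial>atom_law p0 k0) = (\<integral>j. h (atom p0 k0 j) \<partial>measure_pmf (pmf_of_set UNIV))"
    unfolding atom_law_def by (rule integral_distr) (simp_all add: assms)
  also have "\<dots> = (\<Sum>j\<in>UNIV. (1 / (2 * real CARD('p + 'k))) *\<^sub>R h (atom p0 k0 j))"
    by (subst integral_measure_pmf[of UNIV]) (simp_all add: mult.commute)
  also have "\<dots> = (1 / (2 * real CARD('p + 'k))) *\<^sub>R
      (\<Sum>j\<in>UNIV. h (atom p0 k0 (j, True)) + h (atom p0 k0 (j, False)))"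
    unfolding scaleR_sum_right[symmetric] UNIV_Times_UNIV[symmetric] sum.cartesian_product'
    by (simp add: UNIV_bool add.commute)
  also have "(\<Sum>j\<in>UNIV. h (atom p0 k0 (j, True)) + h (atom p0 k0 (j, False))) =
     ((\<Sum>p\<in>UNIV. h (atom p0 k0 (Inl p, True)) + h (atom p0 k0 (Inl p, False))) +
     (\<Sum>k\<in>UNIV. h (atom p0 k0 (Inr k, True)) + h (atom p0 k0 (Inr k, False))))"
    unfolding UNIV_Plus_UNIV[symmetric] by (simp add: sum.Plus del: UNIV_Plus_UNIV)
  finally show ?thesis .
qed

lemma AE_E_rv_atom_law:
  fixes p0 :: "'p::finite" and k0 :: "'k::finite"
  shows "AE \<omega> in (atom_law p0 k0 :: ((real^'p) \<times> (real^'k) \<times> (real^'m::finite)) measure). E_rv \<omega> = 0"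
proof -
  have "E_rv (atom p0 k0 j :: (real^'p) \<times> (real^'k) \<times> (real^'m)) = 0" for j
    by (cases "(p0, k0, j)" rule: atom.cases) (auto simp: E_rv_def)
  then have "AE j in measure_pmf (pmf_of_set UNIV). E_rv (atom p0 k0 j :: (real^'p) \<times> (real^'k) \<times> (real^'m)) = 0"
    by simp
  then show ?thesis
    unfolding atom_law_def by (subst AE_distr_iff) auto
qed

lemma mean_zero_L2_atom_law:
  "mean_zero_L2 (atom_law p0 k0) X_rv" "mean_zero_L2 (atom_law p0 k0) Z_rv"
  "mean_zero_L2 (atom_law p0 k0) E_rv"
proof -
  have [simp]: "axis i 1 + axis i (- 1) = (0::real^'n::finite)" for i
    by (simp add: vec_eq_iff axis_def)
  have [simp]: "(if P then a else 0) + (if P then b else 0) = (if P then a + b else 0)"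
    "(if P then 0 else a) + (if P then 0 else b) = (if P then 0 else a + b)" for P and a b :: "real^'n::finite"
    by simp_all
  show "mean_zero_L2 (atom_law p0 k0) X_rv" "mean_zero_L2 (atom_law p0 k0) Z_rv"
    "mean_zero_L2 (atom_law p0 k0) E_rv"
    unfolding mean_zero_L2_def
    by (auto simp: integral_atom_law integrable_atom_law X_rv_def[of "(_, _)"] Z_rv_def[of "(_, _)"]
        E_rv_def[of "(_, _)"] intro!: sum.neutral)
qed

lemma Cov_eq_second_moment: "mean_zero_L2 M U \<Longrightarrow> Cov M U = second_moment M U U"
  by (simp add: Cov_def mean_zero_L2_def)

text \<open>Flipping the sign negates an atom, and a product of two odd functions does not see this.
  The two equal contributions absorb the factor 2 in the weight.\<close>

lemma second_moment_atom_law_odd: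
  fixes p0 :: "'p::finite" and k0 :: "'k::finite"
    and U :: "(real^'p) \<times> (real^'k) \<times> (real^'m::finite) \<Rightarrow> real^'i::finite"
    and V :: "(real^'p) \<times> (real^'k) \<times> (real^'m) \<Rightarrow> real^'j::finite"
  assumes [measurable]: "\<And>i. (\<lambda>\<omega>. U \<omega> $ i) \<in> borel_measurable borel"
    "\<And>j. (\<lambda>\<omega>. V \<omega> $ j) \<in> borel_measurable borel"
    and odd: "\<And>\<omega>. U (- \<omega>) = - U \<omega>" "\<And>\<omega>. V (- \<omega>) = - V \<omega>"
  shows "second_moment (atom_law p0 k0) U V $ i $ j =
    ((\<Sum>p\<in>UNIV. U (atom p0 k0 (Inl p, True)) $ i * V (atom p0 k0 (Inl p, True)) $ j) +
     (\<Sum>k\<in>UNIV. U (atom p0 k0 (Inr k, True)) $ i * V (atom p0 k0 (Inr k, True)) $ j)) /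
    real CARD('p + 'k)"
proof -
  have "atom p0 k0 (l, False) = - (atom p0 k0 (l, True) :: (real^'p) \<times> (real^'k) \<times> (real^'m))" for l
    by (cases l) (auto simp: axis_def vec_eq_iff)
  then show ?thesis
    by (simp add: second_moment_def integral_atom_law odd add_divide_distrib flip: sum_distrib_left
        del: atom.simps card_sum)
qed

lemma coordinates_odd [simp]:
  "X_rv (- \<omega>) = - X_rv \<omega>" "Z_rv (- \<omega>) = - Z_rv \<omega>" "E_rv (- \<omega>) = - E_rv \<omega>"
  by (simp_all add: X_rv_def Z_rv_def E_rv_def)

lemma coordinates_atom:
  "X_rv (atom p0 k0 (Inl p, True)) $ i = (if i = p then 1 else 0)"
  "X_rv (atom p0 k0 (Inr k, True)) $ i = 0"
  "Z_rv (atom p0 k0 (Inl p, True)) $ j = (if p = p0 then if j = k0 then 1 else 0 else 0)"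
  "Z_rv (atom p0 k0 (Inr k, True)) $ j = (if j = k then if j = k0 then 0 else 1 else 0)"
  "E_rv (atom p0 k0 (s, b)) = 0"
  by (cases s; auto simp: X_rv_def Z_rv_def E_rv_def axis_def)+

text \<open>Each coordinate of X, and each of Z, is nonzero at exactly one tag, and no two
  coordinates of the same vector share a tag. X and Z are jointly nonzero only at
  \<open>Inl p0\<close>.\<close>

lemma second_moment_atom_law:
  fixes p0 :: "'p::finite" and k0 :: "'k::finite"
  defines "M \<equiv> (atom_law p0 k0 :: ((real^'p) \<times> (real^'k) \<times> (real^'m::finite)) measure)"
  shows "second_moment M X_rv X_rv = mat (1 / real CARD('p + 'k))"
    and "second_moment M X_rv Z_rv = (\<chi> p k. if p = p0 \<and> k = k0 then 1 / real CARD('p + 'k) else 0)"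
    and "second_moment M Z_rv Z_rv = mat (1 / real CARD('p + 'k))"
    and "second_moment M E_rv E_rv = 0"
  unfolding M_def
  by (auto simp: vec_eq_iff second_moment_atom_law_odd coordinates_atom mat_def
      if_distrib[of "\<lambda>x. x * _"] simp del: atom.simps card_sum cong: if_cong)

section \<open>Conditions on a configuration: positive definiteness, independence, rank\<close>

lemma pos_def_mat: "0 < c \<Longrightarrow> pos_def (mat c :: real^'n::finite^'n)"
proof -
  assume "0 < c"
  moreover have "mat c *v v = c *\<^sub>R v" for v :: "real^'n"
    by (simp add: vec_eq_iff matrix_vector_mult_def mat_def if_distrib[of "\<lambda>x. x * _"] cong: if_cong)
  ultimately show ?thesis
    by (simp add: pos_def_def transpose_mat)
qed

text \<open>An event generated by U has probability 1 or 0 according to whether the constant lies in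
  the defining set, and such events are independent of everything. It serves the degenerate error E
  = 0.\<close>

lemma indep_rv_AE_const:
  assumes "prob_space M" "U \<in> borel_measurable M" "V \<in> borel_measurable M"
    and U: "AE \<omega> in M. U \<omega> = c"
  shows "indep_rv M U V"
proof -
  interpret prob_space M by fact
  have sub: "sets (vimage_algebra (space M) f borel) \<subseteq> events"
    if "f \<in> borel_measurable M" for f :: "_ \<Rightarrow> 'z::topological_space"
    using that by (auto simp: sets_vimage_algebra2 measurable_sets)
  have "prob (a \<inter> b) = prob a * prob b"
    if a: "a \<in> sets (vimage_algebra (space M) U borel)"
      and b: "b \<in> sets (vimage_algebra (space M) V borel)" for a b
  proof -
    have [measurable]: "a \<in> events" "b \<in> events"
      using a b sub assms(2,3) by blast+
    from a obtain S where S: "a = U -` S \<inter> space M"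
      by (auto simp: sets_vimage_algebra2)
    show ?thesis
    proof (cases "c \<in> S")
      case True
      then have *: "AE \<omega> in M. \<omega> \<in> a"
        using AE_mp[OF U, of "\<lambda>\<omega>. \<omega> \<in> a"] by (auto simp: S)
      then have "prob (a \<inter> b) = prob b"
        by (intro finite_measure_eq_AE) (auto elim: eventually_mono)
      moreover have "prob a = 1"
        using * by (simp add: prob_eq_1)
      ultimately show ?thesis by simp
    next
      case False
      then have *: "AE \<omega> in M. \<omega> \<notin> a"
        using AE_mp[OF U, of "\<lambda>\<omega>. \<omega> \<notin> a"] by (auto simp: S)
      then have "prob a = 0"
        by (simp add: prob_eq_0)
      moreover have "prob (a \<inter> b) \<le> prob a"
        by (intro finite_measure_mono) auto
      ultimately show ?thesis
        using measure_nonneg[of M "a \<inter> b"] by simp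
    qed
  qed
  then show ?thesis
    unfolding indep_rv_def using assms(2,3) sub[OF assms(2)] sub[OF assms(3)]
    by (intro conjI indep_setI) blast+
qed

text \<open>\<open>g\<close> and \<open>m\<close> stay parameters so that the configuration after
  the exchange has the same form.\<close>

definition axis_config ::
    "'p \<Rightarrow> 'k \<Rightarrow> ('k \<Rightarrow> 'm) \<Rightarrow> 'm \<Rightarrow> ('p::finite, 'm::finite, 'k::finite) config" where
  "axis_config p0 k0 g m =
    \<lparr>Psi_mat = (\<chi> p. if p = p0 then axis m 1 else 0),
     B_mat = (\<chi> k. axis (g k) 1),
     law = atom_law p0 k0\<rparr>"

lemma axis_config_sel [simp]:
  "Psi_mat (axis_config p0 k0 g m) = (\<chi> p. if p = p0 then axis m 1 else 0)"
  "B_mat (axis_config p0 k0 g m) = (\<chi> k. axis (g k) 1)"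
  "law (axis_config p0 k0 g m) = atom_law p0 k0"
  by (simp_all add: axis_config_def)

lemma B_mat_axis_config_orthonormal:
  fixes g :: "'k::finite \<Rightarrow> 'm::finite"
  assumes "inj g"
  shows "B_mat (axis_config p0 k0 g m) ** transpose (B_mat (axis_config p0 k0 g m)) = mat 1"
  using assms
  by (auto simp: vec_eq_iff matrix_matrix_mult_def transpose_def mat_def axis_def inj_eq
      if_distrib[of "\<lambda>x. x * _"] cong: if_cong)

lemma configuration_axis_config:
  fixes g :: "'k::finite \<Rightarrow> 'm::finite"
  assumes "inj g"
  shows "configuration (axis_config (p0::'p::finite) k0 g m)"
proof -
  \<comment> \<open>The rows of B are orthonormal, so the identity factors through B and forces full
    row rank.\<close>
  have "rank (mat 1 :: real^'k^'k) \<le> rank (B_mat (axis_config p0 k0 g m))"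
    unfolding B_mat_axis_config_orthonormal[OF assms, of p0 k0 m, symmetric] by (rule rank_mul_le_left)
  moreover have "rank (B_mat (axis_config p0 k0 g m)) \<le> CARD('k)"
    using rank_bound[of "B_mat (axis_config p0 k0 g m)"] by simp
  ultimately have "rank (B_mat (axis_config p0 k0 g m)) = CARD('k)"
    by (simp add: rank_I)
  moreover have "indep_rv (atom_law p0 k0) (E_rv :: (real^'p) \<times> (real^'k) \<times> (real^'m) \<Rightarrow> _)
      (\<lambda>\<omega>. (X_rv \<omega>, Z_rv \<omega>))"
    by (rule indep_rv_AE_const[OF prob_space_atom_law _ _ AE_E_rv_atom_law]) measurable
  moreover have "0 < 1 / real CARD('p + 'k)"
    by (simp only: of_nat_0_less_iff zero_less_card_finite zero_less_divide_1_iff)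
  ultimately show ?thesis
    unfolding configuration_def
    by (simp add: prob_space_atom_law mean_zero_L2_atom_law Cov_eq_second_moment
        second_moment_atom_law pos_def_mat diagonal_def del: card_sum)
qed

section \<open>The residual W: regression matrix, singular covariance, conditional mean\<close>

lemma A_mat_axis_config:
  fixes g :: "'k::finite \<Rightarrow> 'm::finite"
  shows "A_mat (axis_config (p0::'p::finite) k0 g m) = (\<chi> p k. if p = p0 \<and> k = k0 then 1 else 0)"
proof -
  let ?N = "real CARD('p + 'k)"
  \<comment> \<open>Cov(X) is scalar with entry 1/N, so its inverse N merely rescales the cross
    moment, turning its only nonzero entry 1/N into 1.\<close>
  have "mat a ** mat b = (mat (a * b) :: real^'p^'p)" for a b :: real
    by (simp add: vec_eq_iff matrix_matrix_mult_def mat_def if_distrib[of "\<lambda>x. x * _"] cong: if_cong)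
  then have "matrix_inv (mat (1 / ?N) :: real^'p^'p) = mat ?N"
    by (intro matrix_inv_eqI) (simp del: card_sum)
  moreover have "?N \<noteq> 0"
    by (simp only: of_nat_eq_0_iff zero_less_card_finite less_not_refl2 not_False_eq_True)
  ultimately show ?thesis
    unfolding A_mat_def axis_config_sel second_moment_atom_law
    by (simp add: vec_eq_iff matrix_matrix_mult_def mat_def if_distrib[of "\<lambda>x. x * _"]
        del: card_sum cong: if_cong)
qed

lemma W_rv_axis_config:
  "W_rv (axis_config p0 k0 g m) \<omega> = Z_rv \<omega> - axis k0 (X_rv \<omega> $ p0)"
proof -
  have *: "(if P \<and> Q then 1 else 0) * x = (if P then if Q then x else 0 else 0)" for P Q and x :: real
    by simp
  show ?thesis
    unfolding W_rv_def A_mat_axis_config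
    by (auto simp: vec_eq_iff matrix_vector_mult_def transpose_def axis_def *
        simp del: transpose_matrix_vector)
qed

text \<open>At \<open>Inl p0\<close> the copy in Z_k0 cancels against X_p0, so W survives only at
  draws where X = 0.\<close>

lemma W_rv_atom:
  "W_rv (axis_config p0 k0 g m) (atom p0 k0 (Inl p, b)) = 0"
  "W_rv (axis_config p0 k0 g m) (atom p0 k0 (Inr k, b)) =
     (if k = k0 then 0 else axis k (if b then 1 else -1))"
  by (auto simp: W_rv_axis_config X_rv_def Z_rv_def axis_def vec_eq_iff)

text \<open>W_k0 vanishes on all atoms, which puts \<open>axis k0 1\<close> into the kernel of the
  covariance matrix.\<close>

lemma rank_Cov_W_rv_axis_config:
  fixes p0 :: "'p::finite" and k0 :: "'k::finite" and g :: "'k \<Rightarrow> 'm::finite" and m :: 'm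
  defines "c \<equiv> axis_config p0 k0 g m"
  shows "rank (Cov (law c) (W_rv c)) < CARD('k)"
proof -
  have W0: "W_rv c (atom p0 k0 (j, b)) $ k0 = 0" for j b
    by (cases j) (simp_all add: c_def W_rv_atom axis_def del: atom.simps)
  \<comment> \<open>\<open>Cov\<close> centers its argument, so the mean must vanish in coordinate
    k0 before the column does.\<close>
  have "(\<integral>\<omega>. W_rv c \<omega> \<partial>law c) $ k0 = 0"
    by (simp add: c_def integral_atom_law W0[unfolded c_def] del: atom.simps)
  then have "Cov (law c) (W_rv c) $ i $ k0 = 0" for i
    by (simp add: Cov_def second_moment_def)
      (simp add: c_def integral_atom_law W0[unfolded c_def] del: atom.simps)
  then have "Cov (law c) (W_rv c) *v axis k0 1 = 0"
    by (simp add: vec_eq_iff matrix_vector_mult_basis column_def)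
  moreover have "axis k0 1 \<noteq> (0 :: real^'k)"
    by simp
  ultimately show ?thesis
    using matrix_nonfull_linear_equations_eq[of "Cov (law c) (W_rv c)"]
      rank_bound[of "Cov (law c) (W_rv c)"] by fastforce
qed

text \<open>On every atom $W$ or $X$ vanishes, so on the event $X \in S$ the two signs of $W$ cancel.\<close>

lemma cond_mean_zero_axis_config:
  fixes p0 :: "'p::finite" and k0 :: "'k::finite" and g :: "'k \<Rightarrow> 'm::finite" and m :: 'm
  defines "c \<equiv> axis_config p0 k0 g m"
  shows "cond_mean_zero (law c) (W_rv c) X_rv"
  unfolding cond_mean_zero_def
proof
  fix i
  let ?F = "vimage_algebra (space (law c)) X_rv borel"
  have law: "law c = atom_law p0 k0"
    by (simp add: c_def)
  interpret prob_space "law c"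
    unfolding law by (rule prob_space_atom_law)
  have sets_F: "A \<in> sets ?F \<longleftrightarrow> (\<exists>S. A = X_rv -` S \<and> S \<in> sets borel)" for A
    by (subst sets_vimage_algebra2) (auto simp: law)
  have F_borel: "A \<in> sets borel" if "A \<in> sets ?F" for A
    using that measurable_sets[OF measurable_coordinates(1)] by (auto simp: sets_F)
  have subalg: "subalgebra (law c) ?F"
    unfolding subalgebra_def using F_borel by (auto simp: law)
  interpret finite_measure_subalgebra "law c" ?F
    by unfold_locales (rule subalg)
  show "AE \<omega> in law c. real_cond_exp (law c) ?F (\<lambda>\<omega>. W_rv c \<omega> $ i) \<omega> = 0"
  \<comment> \<open>It suffices that W_i integrates to 0 over every event generated by X.\<close>
  proof (rule real_cond_exp_charact)
    fix A assume F: "A \<in> sets ?F"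
    then obtain S where A: "A = X_rv -` S"
      by (auto simp: sets_F)
    have [measurable]: "A \<in> sets borel"
      using F by (rule F_borel)
    let ?h = "\<lambda>\<omega>. indicator A \<omega> *\<^sub>R (W_rv c \<omega> $ i)"
    have h: "?h \<in> borel_measurable borel"
      by measurable
    have "?h (atom p0 k0 (Inl p, True)) + ?h (atom p0 k0 (Inl p, False)) = 0" for p
      unfolding c_def W_rv_atom by simp
    moreover have "?h (atom p0 k0 (Inr k, True)) + ?h (atom p0 k0 (Inr k, False)) = 0" for k
      unfolding c_def W_rv_atom by (auto simp: A X_rv_def axis_def indicator_def)
    ultimately have "(\<integral>\<omega>. ?h \<omega> \<partial>law c) = 0"
      unfolding law integral_atom_law[OF h] by (simp only: sum.neutral_const scaleR_zero_right add_0)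
    then show "(\<integral>\<omega>\<in>A. W_rv c \<omega> $ i \<partial>law c) = (\<integral>\<omega>\<in>A. 0 \<partial>law c)"
      by (simp add: set_lebesgue_integral_def)
  qed (simp_all add: law integrable_atom_law)
qed

section \<open>Invariance of the observable law under the exchange\<close>

lemma Y_rv_axis_config:
  "Y_rv (axis_config p0 k0 g m) \<omega> =
    axis m (X_rv \<omega> $ p0) + (\<Sum>k\<in>UNIV. axis (g k) (Z_rv \<omega> $ k)) + E_rv \<omega>"
  unfolding Y_rv_def
  by (auto simp: vec_eq_iff matrix_vector_mult_def transpose_def axis_def
      if_distrib[of "\<lambda>x. x * _"] if_distrib[of "\<lambda>x. x $ _"] cong: if_cong
      simp del: transpose_matrix_vector intro!: sum.cong)

lemma measurable_Y_rv [measurable]: "Y_rv c \<in> borel_measurable borel"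
  unfolding Y_rv_def X_rv_def Z_rv_def E_rv_def
  by (auto intro!: borel_measurable_continuous_onI continuous_intros
      linear_continuous_on_compose[OF _ matrix_vector_mul_linear] simp del: transpose_matrix_vector)

lemma obs_law_axis_config_swap:
  fixes g :: "'k::finite \<Rightarrow> 'm::finite" and p0 :: "'p::finite"
  shows "obs_law (axis_config p0 k0 g m) = obs_law (axis_config p0 k0 (g(k0 := m)) (g k0))"
proof -
  let ?c = "axis_config p0 k0 g m" and ?c' = "axis_config p0 k0 (g(k0 := m)) (g k0)"
  have "X_rv (atom p0 k0 j :: (real^'p) \<times> (real^'k) \<times> (real^'m)) $ p0 =
      Z_rv (atom p0 k0 j :: (real^'p) \<times> (real^'k) \<times> (real^'m)) $ k0" for j
    by (cases "(p0, k0, j)" rule: atom.cases) (auto simp: X_rv_def Z_rv_def axis_def)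
  \<comment> \<open>Only the summand at k0 depends on the update of \<open>g\<close>. Once split
    off, the exchange swaps the columns carrying X_p0 and Z_k0, which are equal on atoms.\<close>
  then have "Y_rv ?c (atom p0 k0 j) = Y_rv ?c' (atom p0 k0 j)" for j
    unfolding Y_rv_axis_config by (simp add: sum.remove[of UNIV k0])
  then have "AE j in measure_pmf (pmf_of_set UNIV). Y_rv ?c (atom p0 k0 j) = Y_rv ?c' (atom p0 k0 j)"
    by simp
  then have "AE \<omega> in atom_law p0 k0. Y_rv ?c \<omega> = Y_rv ?c' \<omega>"
    unfolding atom_law_def by (subst AE_distr_iff) auto
  then show ?thesis
    unfolding obs_law_def axis_config_sel
    by (intro distr_cong_AE) auto
qed

section \<open>Values of Theta and the nonvanishing condition\<close>

lemma Psi_row_proj_axis_config: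
  fixes p0 :: "'p::finite" and k0 :: "'k::finite" and g :: "'k \<Rightarrow> 'm::finite" and m :: 'm
  assumes "m \<notin> range g"
  defines "c \<equiv> axis_config p0 k0 g m"
  shows "Psi_mat c ** row_proj (B_mat c) = 0"
proof -
  \<comment> \<open>The rows of Psi are 0 or \<open>axis m 1\<close>, orthogonal to all rows of B
    because \<open>m\<close> is outside the range of \<open>g\<close>. As \<open>row_proj\<close>
    begins with the transpose of B, its inverse factor need not be computed.\<close>
  have "Psi_mat c ** transpose (B_mat c) = 0"
    using assms
    by (auto simp: vec_eq_iff matrix_matrix_mult_def transpose_def axis_def intro!: sum.neutral)
  then show ?thesis
    by (simp add: row_proj_def matrix_mul_assoc)
qed

lemma Theta_axis_config:
  assumes "m \<notin> range g"
  shows "Theta (axis_config p0 k0 g m) = Psi_mat (axis_config p0 k0 g m)"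
proof -
  let ?c = "axis_config p0 k0 g m"
  have "Theta ?c + Psi_mat ?c ** row_proj (B_mat ?c) = Psi_mat ?c"
    unfolding Theta_def matrix_add_ldistrib[symmetric] by simp
  then show ?thesis
    by (simp add: Psi_row_proj_axis_config[OF assms] del: axis_config_sel)
qed

text \<open>When Psi is orthogonal to the row space of B, this is all that remains of the
  nonvanishing condition.\<close>

lemma A_mat_B_mat_axis_config_nonzero:
  fixes p0 :: "'p::finite" and k0 :: "'k::finite" and g :: "'k \<Rightarrow> 'm::finite" and m :: 'm
  defines "c \<equiv> axis_config p0 k0 g m"
  shows "A_mat c ** B_mat c \<noteq> 0"
proof -
  have "(A_mat c ** B_mat c) $ p0 $ g k0 = 1"
    by (simp add: c_def A_mat_axis_config matrix_matrix_mult_def axis_def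
        if_distrib[of "\<lambda>x. x * _"] cong: if_cong)
  then show ?thesis by auto
qed

theorem proposition3:
  assumes "CARD('k::finite) < CARD('m::finite)"
  shows "\<not> identifiable_over
    {c :: ('p::finite, 'm, 'k) config.
       configuration c \<and>
       cond_mean_zero (law c) (W_rv c) X_rv \<and>
       Psi_mat c ** row_proj (B_mat c) + A_mat c ** B_mat c \<noteq> 0 \<and>
       rank (Cov (law c) (W_rv c)) < CARD('k)}
    Theta"
    (is "\<not> identifiable_over ?C Theta")
proof -
  \<comment> \<open>K < m leaves room for K distinct columns and a spare one.\<close>
  obtain g :: "'k \<Rightarrow> 'm" where g: "inj g"
    using assms card_le_inj[of "UNIV :: 'k set" "UNIV :: 'm set"] by auto
  have "range g \<noteq> UNIV"
    using assms card_image[OF g] by force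
  then obtain m where m: "m \<notin> range g" by blast
  fix p0 :: 'p and k0 :: 'k
  let ?c = "axis_config p0 k0 g m" and ?c' = "axis_config p0 k0 (g(k0 := m)) (g k0)"
  \<comment> \<open>Moving k0 to the spare column keeps injectivity and makes \<open>g k0\<close>
    the new spare column.\<close>
  have g': "inj (g(k0 := m))" and m': "g k0 \<notin> range (g(k0 := m))"
    using g m by (auto simp: inj_on_def)
  have "?c \<in> ?C"
    using g m by (simp add: configuration_axis_config cond_mean_zero_axis_config
        Psi_row_proj_axis_config A_mat_B_mat_axis_config_nonzero rank_Cov_W_rv_axis_config
        del: axis_config_sel)
  moreover have "?c' \<in> ?C"
    using g' m' by (simp add: configuration_axis_config cond_mean_zero_axis_config
        Psi_row_proj_axis_config A_mat_B_mat_axis_config_nonzero rank_Cov_W_rv_axis_config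
        del: axis_config_sel)
  \<comment> \<open>Theta equals Psi on both sides, so this entry is 1 for \<open>?c\<close> and 0
    for \<open>?c'\<close>, whose Psi sits in column \<open>g k0\<close>.\<close>
  moreover have "Theta ?c $ p0 $ m \<noteq> Theta ?c' $ p0 $ m"
    using m by (simp add: Theta_axis_config[OF m] Theta_axis_config[OF m'] axis_def) auto
  then have "Theta ?c \<noteq> Theta ?c'" by metis
  ultimately show ?thesis
    unfolding identifiable_over_def using obs_law_axis_config_swap by blast
qed

end
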